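(* Let $d\ge 1$ and let $M_1,M_2\subset\mathbb{R}^d$ be closed, disjoint, strictly convex sets such that $M_1\cup M_2$ is centrally symmetric, i.e. $x\in M_1\cup M_2$ if and only if $-x\in M_1\cup M_2$. The sets are not assumed to be bounded. Let $V_1,V_2$ be random vectors in $\mathbb{R}^d$ (the velocities), and let $T$ and $C$ be the collision time and collision location of the moving sets $M_1+sV_1$ and $M_2+sV_2$, $s\ge 0$. If $V_1$ and $V_2$ are independent standard $d$-dimensional normal $\mathcal{N}(\mathbf{0},I_d)$ random vectors, then the conditional distribution of $C$ given $T<\infty$ is rotation invariant, i.e. invariant under the action of the orthogonal group $O(d)$.
   Context: Write $M_i(s)=M_i+sV_i$ for $i=1,2$ and $s\ge 0$. The collision time is $T=\inf\{t\ge 0: M_1(t)\cap M_2(t)\neq\emptyset\}$ (with $\inf\emptyset=\infty$); $T<\infty$ indicates that there is a collision. The collision location $C$ is defined by $\{C\}=M_1(T)\cap M_2(T)$; this intersection contains only one point by the strict convexity of $M_1$ and $M_2$. A closed set $M$ is strictly convex if for any two distinct points of $M$ the open segment between them lies in the interior of $M$. Here $I_d$ is the $d\times d$ identity matrix. *)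

theory Defs
  imports "HOL-Probability.Probability"
begin

definition strictly_convex :: "(real ^ 'n) set \<Rightarrow> bool" where
  "strictly_convex S \<longleftrightarrow>
     (\<forall>x\<in>S. \<forall>y\<in>S. x \<noteq> y \<longrightarrow> open_segment x y \<subseteq> interior S)"

definition moving_set :: "(real ^ 'n) set \<Rightarrow> real ^ 'n \<Rightarrow> real \<Rightarrow> (real ^ 'n) set" where
  "moving_set S v s = (\<lambda>x. x + s *\<^sub>R v) ` S"

text \<open>In the type \<^typ>\<open>ereal\<close> the infimum of the empty set is \<open>\<infinity>\<close>.\<close>

definition collision_time ::
  "(real ^ 'n) set \<Rightarrow> (real ^ 'n) set \<Rightarrow> real ^ 'n \<Rightarrow> real ^ 'n \<Rightarrow> ereal" where
  "collision_time M1 M2 v1 v2 =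
     Inf (ereal ` {t. 0 \<le> t \<and> moving_set M1 v1 t \<inter> moving_set M2 v2 t \<noteq> {}})"

text \<open>The location is meaningful only if the collision time is finite. For disjoint \<open>M1\<close> and
  \<open>M2\<close>, a collision time \<open>\<infinity>\<close> yields the constant dummy value \<open>the_elem {}\<close>, because
  \<open>real_of_ereal \<infinity> = 0\<close>.\<close>

definition collision_location ::
  "(real ^ 'n) set \<Rightarrow> (real ^ 'n) set \<Rightarrow> real ^ 'n \<Rightarrow> real ^ 'n \<Rightarrow> real ^ 'n" where
  "collision_location M1 M2 v1 v2 =
     (let t = real_of_ereal (collision_time M1 M2 v1 v2)
      in the_elem (moving_set M1 v1 t \<inter> moving_set M2 v2 t))"

text \<open>The Lebesgue density of the normal distribution with mean zero and identity covariance matrix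
  on the space of dimension \<open>d = CARD('n)\<close>.\<close>

definition std_normal_vec_density :: "real ^ 'n \<Rightarrow> real" where
  "std_normal_vec_density x = (2 * pi) powr (- (real CARD('n) / 2)) * exp (- (norm x)\<^sup>2 / 2)"

text \<open>The library's \<^const>\<open>uniform_measure\<close> \<open>P A\<close> is \<open>P\<close> conditioned on the event \<open>A\<close>, that is
  \<open>B \<mapsto> P (A \<inter> B) / P A\<close>; it is the zero measure if \<open>A\<close> is a null event.\<close>

definition cond_distr :: "'w measure \<Rightarrow> 'w set \<Rightarrow> ('w \<Rightarrow> real ^ 'n) \<Rightarrow> (real ^ 'n) measure" where
  "cond_distr P A X = distr (uniform_measure P A) borel X"

definition rotation_invariant :: "(real ^ 'n) measure \<Rightarrow> bool" where
  "rotation_invariant \<mu> \<longleftrightarrow>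
     (\<forall>Q :: real ^ 'n ^ 'n. orthogonal_matrix Q \<longrightarrow> distr \<mu> borel (\<lambda>x. Q *v x) = \<mu>)"

end

theory Submission
  imports Defs
begin

text \<open>Unless one of the sets is empty, the reflection swaps the two components of the union, so that
  \<open>M2 = - M1\<close>. By convexity the sets meet at time \<open>t\<close> iff \<open>(t / 2) (V2 - V1) \<in> M1\<close>; hence
  \<open>T\<close> is a function of \<open>V2 - V1\<close>. At the first such time this point lies on the boundary of
  \<open>M1\<close>, and strict convexity leaves \<open>C = T (V1 + V2) / 2\<close> as the only common point.
  Rotating \<open>V1 + V2\<close> while keeping \<open>V2 - V1\<close> preserves the joint distribution, because the joint
  density depends only on the norms of these two vectors.\<close>

section \<open>Invariance of Lebesgue measure under translations and orthogonal maps\<close>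

lemma borel_measurable_orthogonal_transformation:
  fixes f :: "'a::euclidean_space \<Rightarrow> 'a"
  assumes "orthogonal_transformation f"
  shows "f \<in> borel_measurable borel"
  using orthogonal_transformation_linear[OF assms]
  by (intro borel_measurable_continuous_onI linear_continuous_on)
    (simp add: linear_conv_bounded_linear)

lemma nn_integral_lborel_translation:
  fixes f :: "'a::euclidean_space \<Rightarrow> ennreal"
  assumes [measurable]: "f \<in> borel_measurable borel"
  shows "(\<integral>\<^sup>+x. f (x + c) \<partial>lborel) = (\<integral>\<^sup>+x. f x \<partial>lborel)"
proof -
  have "(\<integral>\<^sup>+x. f x \<partial>lborel) = (\<integral>\<^sup>+x. f x \<partial>distr lborel borel ((+) c))"
    by (simp add: lborel_distr_plus)
  also have "\<dots> = (\<integral>\<^sup>+x. f (c + x) \<partial>lborel)"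
    by (rule nn_integral_distr) auto
  finally show ?thesis
    by (simp add: add.commute)
qed

text \<open>The library's \<open>measure_orthogonal_image\<close> needs a wellordered index type. The proof below is
  the uniqueness argument for Haar measure: translation invariance and Tonelli give
  \<open>\<lambda> B * \<mu> A = \<lambda> A * \<mu> B\<close> for the image \<open>\<mu>\<close> of Lebesgue measure \<open>\<lambda>\<close> and
  the unit ball \<open>B\<close>, and \<open>\<mu> B = \<lambda> B\<close>.\<close>

lemma lborel_distr_orthogonal:
  fixes f :: "'a::euclidean_space \<Rightarrow> 'a"
  assumes f: "orthogonal_transformation f"
  shows "distr lborel borel f = lborel"
proof (rule measure_eqI)
  show "sets (distr lborel borel f) = sets lborel"
    by simp
next
  fix A assume "A \<in> sets (distr lborel borel f)"
  then have [measurable]: "A \<in> sets borel"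
    by simp
  have lin: "linear f"
    using f by (rule orthogonal_transformation_linear)
  have [measurable]: "f \<in> borel_measurable borel"
    using f by (rule borel_measurable_orthogonal_transformation)
  \<comment> \<open>A linear right inverse \<open>g\<close> pulls a shift by \<open>x\<close> of the
    values of \<open>f\<close> back to a shift by \<open>g x\<close> of its argument.\<close>
  obtain g where g: "linear g" "\<And>x. f (g x) = x"
    using orthogonal_transformation_surj[OF f] lin linear_surjective_right_inverse
    by (metis comp_apply id_apply)
  define B where "B = ball (0::'a) 1"
  have [measurable]: "B \<in> sets borel"
    by (simp add: B_def)
  \<comment> \<open>The difference \<open>f x - y\<close> is \<open>f (x - g y)\<close>; since
    \<open>f\<close> preserves norms and the ball is symmetric, only the norm of
    \<open>g y - x\<close> matters.\<close>
  have fB: "indicator B (f x - y) = (indicator B (g y - x) :: ennreal)" for x y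
  proof -
    have "norm (f x - y) = norm (f (x - g y))"
      by (simp add: linear_diff[OF lin] g)
    also have "\<dots> = norm (g y - x)"
      using orthogonal_transformation_norm[OF f] by (simp add: norm_minus_commute)
    finally show ?thesis
      by (simp add: B_def indicator_def)
  qed
  have shift: "(\<integral>\<^sup>+y. indicator A (f y + x) \<partial>lborel) = emeasure (distr lborel borel f) A" for x
  proof -
    have "(\<integral>\<^sup>+y. indicator A (f y + x) \<partial>lborel) = (\<integral>\<^sup>+y. indicator A (f (y + g x)) \<partial>lborel)"
      by (simp add: linear_add[OF lin] g)
    also have "\<dots> = (\<integral>\<^sup>+y. indicator A (f y) \<partial>lborel)"
      by (rule nn_integral_lborel_translation) measurable
    also have "\<dots> = (\<integral>\<^sup>+y. indicator A y \<partial>distr lborel borel f)"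
      by (rule nn_integral_distr[symmetric]) auto
    finally show ?thesis
      by simp
  qed
  \<comment> \<open>For each \<open>x\<close>, the points \<open>y\<close> with
    \<open>x - f y\<close> in \<open>B\<close> form the unit ball around \<open>g x\<close>, a
    translate of \<open>B\<close>.\<close>
  have shiftB: "(\<integral>\<^sup>+y. indicator B (x - f y) \<partial>lborel) = emeasure lborel B" for x
  proof -
    have "(\<integral>\<^sup>+y. indicator B (x - f y) \<partial>lborel) = (\<integral>\<^sup>+y. indicator B (f y - x) \<partial>lborel)"
      by (simp add: B_def indicator_def norm_minus_commute)
    also have "\<dots> = (\<integral>\<^sup>+y. indicator B (y + (- g x)) \<partial>lborel)"
      by (subst fB) (simp add: B_def indicator_def norm_minus_commute)
    also have "\<dots> = (\<integral>\<^sup>+y. indicator B y \<partial>lborel)"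
      by (rule nn_integral_lborel_translation) measurable
    finally show ?thesis
      by simp
  qed
  have "emeasure lborel B * emeasure (distr lborel borel f) A
      = (\<integral>\<^sup>+x. (\<integral>\<^sup>+y. indicator B x * indicator A (f y + x) \<partial>lborel) \<partial>lborel)"
    by (simp add: nn_integral_cmult nn_integral_multc shift)
  also have "\<dots> = (\<integral>\<^sup>+y. (\<integral>\<^sup>+x. indicator B x * indicator A (f y + x) \<partial>lborel) \<partial>lborel)"
    by (rule lborel_pair.Fubini') measurable
  \<comment> \<open>For fixed \<open>y\<close>, translating \<open>x\<close> by \<open>f y\<close>
    moves the shift from \<open>A\<close> to \<open>B\<close>.\<close>
  also have "\<dots> = (\<integral>\<^sup>+y. (\<integral>\<^sup>+x. indicator B (x - f y) * indicator A x \<partial>lborel) \<partial>lborel)"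
  proof (rule nn_integral_cong)
    fix y
    show "(\<integral>\<^sup>+x. indicator B x * indicator A (f y + x) \<partial>lborel)
        = (\<integral>\<^sup>+x. indicator B (x - f y) * (indicator A x :: ennreal) \<partial>lborel)"
      by (subst nn_integral_lborel_translation[of _ "f y", symmetric])
        (auto simp: add.commute)
  qed
  also have "\<dots> = (\<integral>\<^sup>+x. (\<integral>\<^sup>+y. indicator B (x - f y) * indicator A x \<partial>lborel) \<partial>lborel)"
    by (rule lborel_pair.Fubini') measurable
  also have "\<dots> = emeasure lborel B * emeasure lborel A"
    by (simp add: nn_integral_cmult nn_integral_multc shiftB)
  finally have "emeasure lborel B * emeasure (distr lborel borel f) A
      = emeasure lborel B * emeasure lborel A" .
  \<comment> \<open>The common factor cancels because the unit ball has positive and finite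
    volume.\<close>
  moreover have "emeasure lborel B \<noteq> 0"
    using content_ball_pos[of 1 "0::'a"] unfolding B_def by (auto simp: measure_def)
  moreover have "emeasure lborel B \<noteq> \<infinity>"
    unfolding B_def using emeasure_lborel_ball_finite[of "0::'a" 1] by simp
  ultimately show "emeasure (distr lborel borel f) A = emeasure lborel A"
    by (simp add: ennreal_mult_cancel_left)
qed

lemma nn_integral_lborel_orthogonal:
  fixes f :: "'a::euclidean_space \<Rightarrow> 'a" and h :: "'a \<Rightarrow> ennreal"
  assumes f: "orthogonal_transformation f" and [measurable]: "h \<in> borel_measurable borel"
  shows "(\<integral>\<^sup>+x. h (f x) \<partial>lborel) = (\<integral>\<^sup>+x. h x \<partial>lborel)"
proof -
  have "f \<in> borel_measurable borel"
    using f by (rule borel_measurable_orthogonal_transformation)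
  then have "(\<integral>\<^sup>+x. h (f x) \<partial>lborel) = (\<integral>\<^sup>+x. h x \<partial>distr lborel borel f)"
    by (subst nn_integral_distr) auto
  then show ?thesis
    by (simp add: lborel_distr_orthogonal[OF f])
qed

section \<open>Sum and difference of independent standard normal vectors\<close>

text \<open>By the parallelogram law the mixed inner products cancel when the two exponents are
  added, so the joint density splits into radial factors in \<open>u\<close> and
  \<open>w\<close>.\<close>

lemma std_normal_vec_density_mult:
  fixes u w :: "real ^ 'n"
  shows "std_normal_vec_density (u - (1/2) *\<^sub>R w) * std_normal_vec_density (u + (1/2) *\<^sub>R w)
    = (2 * pi) powr (- real CARD('n)) * exp (- (norm u)\<^sup>2 - (norm w)\<^sup>2 / 4)"
proof -
  have "- (norm (u - (1/2) *\<^sub>R w))\<^sup>2 / 2 + - (norm (u + (1/2) *\<^sub>R w))\<^sup>2 / 2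
      = - (norm u)\<^sup>2 - (norm w)\<^sup>2 / 4"
    by (simp add: power2_norm_eq_inner inner_simps inner_commute field_simps)
  then show ?thesis
    by (simp add: std_normal_vec_density_def mult_ac powr_add[symmetric] exp_add[symmetric])
qed

text \<open>Change of variables to the half-sum \<open>u\<close> and the difference
  \<open>w\<close>, where \<open>V1\<close> is \<open>u - w/2\<close> and \<open>V2\<close> is
  \<open>u + w/2\<close>. It is a composition of two translations, each in one variable with the
  other held fixed, with Tonelli in between.\<close>

lemma (in prob_space) nn_integral_indep_normal_sum_difference:
  fixes V1 V2 :: "'a \<Rightarrow> real ^ 'n" and h :: "real ^ 'n \<Rightarrow> real ^ 'n \<Rightarrow> ennreal"
  assumes V1: "distributed M lborel V1 (\<lambda>x. ennreal (std_normal_vec_density x))"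
    and V2: "distributed M lborel V2 (\<lambda>x. ennreal (std_normal_vec_density x))"
    and indep: "indep_var borel V1 borel V2"
    and [measurable]: "case_prod h \<in> borel_measurable (borel \<Otimes>\<^sub>M borel)"
  shows "(\<integral>\<^sup>+\<omega>. h ((1/2) *\<^sub>R (V1 \<omega> + V2 \<omega>)) (V2 \<omega> - V1 \<omega>) \<partial>M)
    = (\<integral>\<^sup>+w. (\<integral>\<^sup>+u. ennreal ((2 * pi) powr (- real CARD('n)) * exp (- (norm u)\<^sup>2 - (norm w)\<^sup>2 / 4))
          * h u w \<partial>lborel) \<partial>lborel)"
proof -
  define D :: "real ^ 'n \<Rightarrow> ennreal" where "D x = ennreal (std_normal_vec_density x)" for x
  have [measurable]: "D \<in> borel_measurable borel"
    unfolding D_def std_normal_vec_density_def by measurable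
  have density: "D (u - (1/2) *\<^sub>R w) * D (u + (1/2) *\<^sub>R w)
      = ennreal ((2 * pi) powr (- real CARD('n)) * exp (- (norm u)\<^sup>2 - (norm w)\<^sup>2 / 4))" for u w
    unfolding D_def std_normal_vec_density_mult[symmetric]
    by (rule ennreal_mult[symmetric]) (auto simp: std_normal_vec_density_def)
  have rv: "random_variable borel V1" "random_variable borel V2"
    and prod: "distr M borel V1 \<Otimes>\<^sub>M distr M borel V2 = distr M (borel \<Otimes>\<^sub>M borel) (\<lambda>\<omega>. (V1 \<omega>, V2 \<omega>))"
    using indep by (auto simp: indep_var_distribution_eq)
  note rv[measurable]
  \<comment> \<open>\<open>lborel\<close> and \<open>borel\<close> have the same measurable sets, so
    the product form of the law carries over to the base measures of the densities.\<close>
  have "distr M lborel V1 \<Otimes>\<^sub>M distr M lborel V2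
      = distr M (lborel \<Otimes>\<^sub>M lborel) (\<lambda>\<omega>. (V1 \<omega>, V2 \<omega>))"
    using prod by (simp cong: distr_cong sets_pair_measure_cong)
  then have joint: "distributed M (lborel \<Otimes>\<^sub>M lborel) (\<lambda>\<omega>. (V1 \<omega>, V2 \<omega>)) (\<lambda>(x, y). D x * D y)"
    using V1 V2 unfolding D_def
    by (intro distributed_joint_indep') (auto intro: sigma_finite_lborel)
  have "(\<integral>\<^sup>+\<omega>. h ((1/2) *\<^sub>R (V1 \<omega> + V2 \<omega>)) (V2 \<omega> - V1 \<omega>) \<partial>M)
      = (\<integral>\<^sup>+z. (case z of (x, y) \<Rightarrow> D x * D y)
          * (case z of (x, y) \<Rightarrow> h ((1/2) *\<^sub>R (x + y)) (y - x)) \<partial>(lborel \<Otimes>\<^sub>M lborel))"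
    by (subst distributed_nn_integral[OF joint]) auto
  also have "\<dots> = (\<integral>\<^sup>+x. (\<integral>\<^sup>+y. D x * D y * h ((1/2) *\<^sub>R (x + y)) (y - x) \<partial>lborel) \<partial>lborel)"
    by (subst lborel.nn_integral_fst[symmetric]) auto
  \<comment> \<open>First translation: for fixed \<open>x\<close>, put
    \<open>y = w + x\<close>.\<close>
  also have "\<dots> = (\<integral>\<^sup>+x. (\<integral>\<^sup>+w. D x * D (w + x) * h (x + (1/2) *\<^sub>R w) w \<partial>lborel) \<partial>lborel)"
  proof (rule nn_integral_cong)
    fix x :: "real ^ 'n"
    have "(1/2) *\<^sub>R (x + (w + x)) = x + (1/2) *\<^sub>R w" for w
      by (metis (no_types) add.commute add.left_commute scaleR_add_right scaleR_half_double)
    then show "(\<integral>\<^sup>+y. D x * D y * h ((1/2) *\<^sub>R (x + y)) (y - x) \<partial>lborel)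
        = (\<integral>\<^sup>+w. D x * D (w + x) * h (x + (1/2) *\<^sub>R w) w \<partial>lborel)"
      by (subst nn_integral_lborel_translation[of _ x, symmetric]) auto
  qed
  also have "\<dots> = (\<integral>\<^sup>+w. (\<integral>\<^sup>+x. D x * D (w + x) * h (x + (1/2) *\<^sub>R w) w \<partial>lborel) \<partial>lborel)"
    by (rule lborel_pair.Fubini') measurable
  \<comment> \<open>Second translation: for fixed \<open>w\<close>, put
    \<open>x = u - w/2\<close>.\<close>
  also have "\<dots> = (\<integral>\<^sup>+w. (\<integral>\<^sup>+u. D (u - (1/2) *\<^sub>R w) * D (u + (1/2) *\<^sub>R w) * h u w \<partial>lborel) \<partial>lborel)"
  proof (rule nn_integral_cong)
    fix w :: "real ^ 'n"
    have "x + (1/2) *\<^sub>R w + (1/2) *\<^sub>R w = w + x" for x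
      by (metis (no_types) add.assoc add.commute scaleR_add_right scaleR_half_double)
    then show "(\<integral>\<^sup>+x. D x * D (w + x) * h (x + (1/2) *\<^sub>R w) w \<partial>lborel)
        = (\<integral>\<^sup>+u. D (u - (1/2) *\<^sub>R w) * D (u + (1/2) *\<^sub>R w) * h u w \<partial>lborel)"
      by (subst nn_integral_lborel_translation[of _ "(1/2) *\<^sub>R w", symmetric]) auto
  qed
  finally show ?thesis
    by (simp only: density)
qed

text \<open>For fixed \<open>w\<close> the weight depends on \<open>u\<close> only through its norm,
  so the inner integral over \<open>u\<close> is unchanged when \<open>u\<close> is replaced by
  \<open>Q u\<close>.\<close>

lemma (in prob_space) nn_integral_indep_normal_rotate_sum:
  fixes V1 V2 :: "'a \<Rightarrow> real ^ 'n" and h :: "real ^ 'n \<Rightarrow> real ^ 'n \<Rightarrow> ennreal"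
  assumes V: "distributed M lborel V1 (\<lambda>x. ennreal (std_normal_vec_density x))"
      "distributed M lborel V2 (\<lambda>x. ennreal (std_normal_vec_density x))"
      "indep_var borel V1 borel V2"
    and h[measurable]: "case_prod h \<in> borel_measurable (borel \<Otimes>\<^sub>M borel)"
    and Q: "orthogonal_transformation Q"
  shows "(\<integral>\<^sup>+\<omega>. h (Q ((1/2) *\<^sub>R (V1 \<omega> + V2 \<omega>))) (V2 \<omega> - V1 \<omega>) \<partial>M)
    = (\<integral>\<^sup>+\<omega>. h ((1/2) *\<^sub>R (V1 \<omega> + V2 \<omega>)) (V2 \<omega> - V1 \<omega>) \<partial>M)"
proof -
  have [measurable]: "Q \<in> borel_measurable borel"
    using Q by (rule borel_measurable_orthogonal_transformation)
  define g where "g w u = ennreal ((2 * pi) powr (- real CARD('n))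
      * exp (- (norm u)\<^sup>2 - (norm w)\<^sup>2 / 4)) * h u w" for w u :: "real ^ 'n"
  have "(\<integral>\<^sup>+\<omega>. h (Q ((1/2) *\<^sub>R (V1 \<omega> + V2 \<omega>))) (V2 \<omega> - V1 \<omega>) \<partial>M)
      = (\<integral>\<^sup>+w. (\<integral>\<^sup>+u. g w (Q u) \<partial>lborel) \<partial>lborel)"
    by (subst nn_integral_indep_normal_sum_difference[OF V, where h = "\<lambda>u w. h (Q u) w"])
      (auto simp: g_def orthogonal_transformation_norm[OF Q])
  also have "\<dots> = (\<integral>\<^sup>+w. (\<integral>\<^sup>+u. g w u \<partial>lborel) \<partial>lborel)"
    by (intro nn_integral_cong nn_integral_lborel_orthogonal[OF Q]) (simp add: g_def)
  also have "\<dots> = (\<integral>\<^sup>+\<omega>. h ((1/2) *\<^sub>R (V1 \<omega> + V2 \<omega>)) (V2 \<omega> - V1 \<omega>) \<partial>M)"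
    by (simp only: g_def nn_integral_indep_normal_sum_difference[OF V h])
  finally show ?thesis .
qed

text \<open>The event and the scalar factor depend on the difference alone. On the event, rotating
  \<open>X\<close> therefore amounts to rotating the half-sum with the difference kept fixed, which
  preserves their joint law.\<close>

lemma (in prob_space) rotation_invariant_cond_distr_scaled_sum:
  fixes V1 V2 X :: "'a \<Rightarrow> real ^ 'n" and \<tau> :: "real ^ 'n \<Rightarrow> ereal"
  assumes V: "distributed M lborel V1 (\<lambda>x. ennreal (std_normal_vec_density x))"
      "distributed M lborel V2 (\<lambda>x. ennreal (std_normal_vec_density x))"
      "indep_var borel V1 borel V2"
    and [measurable]: "\<tau> \<in> borel_measurable borel" "X \<in> borel_measurable M"
    and X: "\<And>\<omega>. \<omega> \<in> space M \<Longrightarrow> \<tau> (V2 \<omega> - V1 \<omega>) < \<infinity> \<Longrightarrow>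
      X \<omega> = real_of_ereal (\<tau> (V2 \<omega> - V1 \<omega>)) *\<^sub>R ((1/2) *\<^sub>R (V1 \<omega> + V2 \<omega>))"
  shows "rotation_invariant (cond_distr M {\<omega> \<in> space M. \<tau> (V2 \<omega> - V1 \<omega>) < \<infinity>} X)"
  unfolding rotation_invariant_def
proof (intro allI impI)
  fix Q :: "real ^ 'n ^ 'n" assume "orthogonal_matrix Q"
  then have Q: "orthogonal_transformation ((*v) Q)"
    by (simp add: orthogonal_transformation_matrix)
  have [measurable]: "(*v) Q \<in> borel_measurable borel"
    using Q by (rule borel_measurable_orthogonal_transformation)
  have [measurable]: "V1 \<in> borel_measurable M" "V2 \<in> borel_measurable M"
    using V(1,2) by (auto simp: distributed_def)
  define A where "A = {\<omega> \<in> space M. \<tau> (V2 \<omega> - V1 \<omega>) < \<infinity>}"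
  have A: "A \<in> sets M"
    unfolding A_def by measurable
  \<comment> \<open>Conditioning divides both sides by the mass of \<open>A\<close>, so the
    unnormalised masses on \<open>A\<close> are compared.\<close>
  have eq: "emeasure M (A \<inter> ((\<lambda>\<omega>. Q *v X \<omega>) -` B \<inter> space M)) = emeasure M (A \<inter> (X -` B \<inter> space M))"
    if [measurable]: "B \<in> sets borel" for B
  proof -
    \<comment> \<open>With the half-sum and the difference inserted, \<open>h\<close> is the
      indicator of the event that \<open>A\<close> occurs and \<open>X\<close> lies in
      \<open>B\<close>.\<close>
    define h :: "real ^ 'n \<Rightarrow> real ^ 'n \<Rightarrow> ennreal" where
      "h u w = indicator {..<\<infinity>} (\<tau> w) * indicator B (real_of_ereal (\<tau> w) *\<^sub>R u)" for u w
    have h: "case_prod h \<in> borel_measurable (borel \<Otimes>\<^sub>M borel)"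
      unfolding h_def by measurable
    have "emeasure M (A \<inter> ((\<lambda>\<omega>. Q *v X \<omega>) -` B \<inter> space M))
        = (\<integral>\<^sup>+\<omega>. indicator (A \<inter> ((\<lambda>\<omega>. Q *v X \<omega>) -` B \<inter> space M)) \<omega> \<partial>M)"
      by (intro nn_integral_indicator[symmetric] sets.Int A measurable_sets[of _ _ borel]) auto
    also have "\<dots> = (\<integral>\<^sup>+\<omega>. h (Q *v ((1/2) *\<^sub>R (V1 \<omega> + V2 \<omega>))) (V2 \<omega> - V1 \<omega>) \<partial>M)"
      by (intro nn_integral_cong)
        (auto simp: A_def h_def X matrix_vector_mult_scaleR split: split_indicator)
    also have "\<dots> = (\<integral>\<^sup>+\<omega>. h ((1/2) *\<^sub>R (V1 \<omega> + V2 \<omega>)) (V2 \<omega> - V1 \<omega>) \<partial>M)"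
      by (rule nn_integral_indep_normal_rotate_sum[OF V h Q])
    also have "\<dots> = (\<integral>\<^sup>+\<omega>. indicator (A \<inter> (X -` B \<inter> space M)) \<omega> \<partial>M)"
      by (intro nn_integral_cong) (auto simp: A_def h_def X split: split_indicator)
    also have "\<dots> = emeasure M (A \<inter> (X -` B \<inter> space M))"
      by (intro nn_integral_indicator sets.Int A measurable_sets[of _ _ borel]) auto
    finally show ?thesis .
  qed
  have "distr (cond_distr M A X) borel ((*v) Q) = distr (uniform_measure M A) borel (\<lambda>\<omega>. Q *v X \<omega>)"
    unfolding cond_distr_def by (subst distr_distr) (auto simp: comp_def)
  also have "\<dots> = cond_distr M A X"
    unfolding cond_distr_def using A eq
    by (intro measure_eqI) (auto simp: emeasure_distr)
  finally show "distr (cond_distr M A X) borel ((*v) Q) = cond_distr M A X" .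
qed

section \<open>Strict convexity and central symmetry\<close>

lemma strictly_convex_imp_convex: "strictly_convex S \<Longrightarrow> convex S"
  unfolding strictly_convex_def convex_contains_segment closed_segment_eq_open
  using interior_subset by fastforce

text \<open>Distinct points would have their midpoint in the interior. This is the source of the
  uniqueness of the collision point.\<close>

lemma strictly_convex_midpoint_interior:
  assumes "strictly_convex S" "x \<in> S" "y \<in> S" "midpoint x y \<notin> interior S"
  shows "x = y"
  using assms unfolding strictly_convex_def by (metis midpoint_in_open_segment subsetD)

lemma convex_antipodal_imp_zero_mem:
  fixes S :: "'a::real_vector set"
  assumes "convex S" "x \<in> S" "- x \<in> S"
  shows "0 \<in> S"
  using convexD[OF assms, of "1/2" "1/2"] by simp

text \<open>Reflection permutes the components of the union; neither set can be its own reflection,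
  because only one of them can contain the origin.\<close>

lemma uminus_image_subset_of_symmetric_union:
  fixes A B :: "'a::real_normed_vector set"
  assumes "closed A" "closed B" "convex A" "convex B" "A \<inter> B = {}" "B \<noteq> {}"
    and sym: "\<And>x. x \<in> A \<union> B \<Longrightarrow> - x \<in> A \<union> B"
  shows "uminus ` A \<subseteq> B"
proof -
  have "connected (uminus ` A)"
    using convex_negations[OF \<open>convex A\<close>] by (rule convex_connected)
  moreover have sub: "uminus ` A \<subseteq> A \<union> B"
    using sym by auto
  \<comment> \<open>A connected set covered by two disjoint closed sets misses one of them.\<close>
  ultimately consider "A \<inter> uminus ` A = {}" | "B \<inter> uminus ` A = {}"
    using connected_closedD[of "uminus ` A" A B] assms by blast
  then show ?thesis
  proof cases
    case 1
    then show ?thesis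
      using sub by blast
  next
    \<comment> \<open>Here \<open>A\<close> contains its own reflection and hence, unless empty, the
      origin. Then \<open>B\<close> is also closed under reflection, which would put the origin into
      \<open>B\<close> as well.\<close>
    case 2
    show ?thesis
    proof (cases "A = {}")
      case False
      with 2 sub obtain a where "a \<in> A" "- a \<in> A"
        by blast
      then have "0 \<in> A"
        using convex_antipodal_imp_zero_mem[OF \<open>convex A\<close>] by blast
      obtain b where "b \<in> B"
        using \<open>B \<noteq> {}\<close> by blast
      then have "- b \<notin> A"
        using 2 by (metis disjoint_iff image_eqI minus_minus)
      then have "- b \<in> B"
        using sym \<open>b \<in> B\<close> by blast
      then have "0 \<in> B"
        using convex_antipodal_imp_zero_mem[OF \<open>convex B\<close> \<open>b \<in> B\<close>] by blast
      then show ?thesis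
        using \<open>0 \<in> A\<close> \<open>A \<inter> B = {}\<close> by blast
    qed simp
  qed
qed

section \<open>The first time at which a ray from the origin hits a closed set\<close>

text \<open>Extended real values give a ray that misses \<open>S\<close> the time \<infinity>,
  matching \<open>collision_time\<close>.\<close>

definition hitting_time :: "'a::real_vector set \<Rightarrow> 'a \<Rightarrow> ereal" where
  "hitting_time S w = Inf (ereal ` {t. 0 \<le> t \<and> t *\<^sub>R w \<in> S})"

text \<open>The set of hitting times is closed as a preimage, nonempty and bounded below by 0, so it
  contains its infimum.\<close>

lemma hitting_time_attained:
  fixes S :: "'a::real_normed_vector set"
  assumes "closed S" "hitting_time S w < \<infinity>"
  obtains t where "0 \<le> t" "hitting_time S w = ereal t" "t *\<^sub>R w \<in> S"
    "\<And>s. 0 \<le> s \<Longrightarrow> s *\<^sub>R w \<in> S \<Longrightarrow> t \<le> s"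
proof -
  define H where "H = {t. 0 \<le> t \<and> t *\<^sub>R w \<in> S}"
  have "H = {0..} \<inter> (\<lambda>t. t *\<^sub>R w) -` S"
    by (auto simp: H_def)
  moreover have "closed ((\<lambda>t::real. t *\<^sub>R w) -` S)"
    using \<open>closed S\<close> by (intro closed_vimage continuous_intros)
  ultimately have "closed H"
    by auto
  moreover have "H \<noteq> {}"
    using assms(2) by (auto simp: hitting_time_def H_def[symmetric] top_ereal_def)
  moreover have bdd: "bdd_below H"
    by (rule bdd_belowI[of _ 0]) (simp add: H_def)
  ultimately have mem: "Inf H \<in> H"
    by (intro closed_contains_Inf)
  have low: "Inf H \<le> s" if "s \<in> H" for s
    using that bdd by (rule cInf_lower)
  have "hitting_time S w = ereal (Inf H)"
    unfolding hitting_time_def H_def[symmetric] using mem low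
    by (intro antisym Inf_lower Inf_greatest) auto
  then show ?thesis
    using that[of "Inf H"] mem low by (auto simp: H_def)
qed

text \<open>The sublevel set at a real level \<open>r\<close> is closed: it is the projection of a
  closed set of pairs along the compact time interval from 0 to \<open>r\<close>.\<close>

lemma borel_measurable_hitting_time:
  fixes S :: "'a::euclidean_space set"
  assumes "closed S"
  shows "hitting_time S \<in> borel_measurable borel"
  unfolding borel_measurable_iff_Iic_ereal
proof
  fix a :: ereal
  show "hitting_time S -` {..a} \<inter> space borel \<in> sets borel"
  proof (cases a)
    case (real r)
    \<comment> \<open>The forward direction rests on the infimum being attained.\<close>
    have "hitting_time S w \<le> a \<longleftrightarrow> (\<exists>t\<in>{0..r}. t *\<^sub>R w \<in> S)" for w
    proof
      assume le: "hitting_time S w \<le> a"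
      then have "hitting_time S w < \<infinity>"
        using real by auto
      with assms obtain t where "0 \<le> t" "hitting_time S w = ereal t" "t *\<^sub>R w \<in> S"
        by (rule hitting_time_attained)
      then show "\<exists>t\<in>{0..r}. t *\<^sub>R w \<in> S"
        using le real by auto
    next
      assume "\<exists>t\<in>{0..r}. t *\<^sub>R w \<in> S"
      then obtain t where "0 \<le> t" "t \<le> r" "t *\<^sub>R w \<in> S"
        by auto
      then show "hitting_time S w \<le> a"
        unfolding hitting_time_def real by (intro Inf_lower2[of "ereal t"]) auto
    qed
    then have "hitting_time S -` {..a} = {w. \<exists>t. t \<in> {0..r} \<and> (t, w) \<in> (\<lambda>(t, w). t *\<^sub>R w) -` S}"
      by (simp add: vimage_def Bex_def)
    moreover have "closed ((\<lambda>(t::real, w). t *\<^sub>R w) -` S)"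
      using assms by (intro closed_vimage) (auto intro!: continuous_intros simp: split_beta)
    then have "closed {w. \<exists>t. t \<in> {0..r} \<and> (t, w) \<in> (\<lambda>(t, w). t *\<^sub>R w) -` S}"
      by (intro closed_compact_projection) auto
    ultimately show ?thesis
      by simp
  next
    case MInf
    have "0 \<le> hitting_time S w" for w
      unfolding hitting_time_def by (auto intro!: Inf_greatest)
    then have "hitting_time S -` {..a} = {}"
      using MInf by auto
    then show ?thesis
      by simp
  qed (simp add: atMost_def)
qed

text \<open>Since the origin is outside \<open>S\<close>, a hit occurs at a positive time; from an
  interior point one could step back to an earlier hit.\<close>

lemma hitting_point_notin_interior:
  fixes S :: "'a::real_normed_vector set"
  assumes "0 \<notin> S" "0 \<le> t" "\<And>s. 0 \<le> s \<Longrightarrow> s *\<^sub>R w \<in> S \<Longrightarrow> t \<le> s"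
  shows "t *\<^sub>R w \<notin> interior S"
proof
  assume int: "t *\<^sub>R w \<in> interior S"
  then have "t \<noteq> 0"
    using \<open>0 \<notin> S\<close> interior_subset by (metis scale_zero_left subsetD)
  have "open ((\<lambda>s::real. s *\<^sub>R w) -` interior S)"
    by (intro open_vimage continuous_intros open_interior)
  then have "\<exists>e>0. \<forall>s. dist s t < e \<longrightarrow> s *\<^sub>R w \<in> interior S"
    using int by (simp add: open_dist)
  then obtain e where e: "0 < e" "\<And>s. dist s t < e \<Longrightarrow> s *\<^sub>R w \<in> interior S"
    by metis
  \<comment> \<open>Half of \<open>e\<close> keeps \<open>s\<close> strictly within the radius, and
    the maximum keeps it a legitimate time; \<open>s < t\<close> because \<open>t\<close> is
    positive.\<close>
  define s where "s = max 0 (t - e / 2)"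
  have "0 \<le> s" "s < t" "dist s t < e"
    using e(1) \<open>0 \<le> t\<close> \<open>t \<noteq> 0\<close> unfolding s_def dist_real_def by linarith+
  then show False
    using e(2) assms(3) interior_subset by (metis not_le subsetD)
qed

section \<open>Collision of a convex set with its reflection\<close>

text \<open>A common point arises from \<open>x\<close> and \<open>- y\<close> with
  \<open>x + y = t (v2 - v1)\<close>, so the right-hand point is the midpoint of \<open>x\<close>
  and \<open>y\<close>. Conversely, that point itself serves as both \<open>x\<close> and
  \<open>y\<close>.\<close>

lemma moving_set_reflection_Int_nonempty_iff:
  assumes "convex M"
  shows "moving_set M v1 t \<inter> moving_set (uminus ` M) v2 t \<noteq> {} \<longleftrightarrow> t *\<^sub>R ((1/2) *\<^sub>R (v2 - v1)) \<in> M"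
proof
  assume "moving_set M v1 t \<inter> moving_set (uminus ` M) v2 t \<noteq> {}"
  then obtain x y where xy: "x \<in> M" "y \<in> M" "x + t *\<^sub>R v1 = - y + t *\<^sub>R v2"
    by (auto simp: moving_set_def)
  then have "x + y = t *\<^sub>R (v2 - v1)"
    by (simp add: algebra_simps)
  then have "t *\<^sub>R ((1/2) *\<^sub>R (v2 - v1)) = (1/2) *\<^sub>R x + (1/2) *\<^sub>R y"
    by (metis scaleR_add_right scaleR_left_commute)
  also have "\<dots> \<in> M"
    using convexD[OF assms xy(1,2), of "1/2" "1/2"] by simp
  finally show "t *\<^sub>R ((1/2) *\<^sub>R (v2 - v1)) \<in> M" .
next
  define p where "p = t *\<^sub>R ((1/2) *\<^sub>R (v2 - v1))"
  assume "t *\<^sub>R ((1/2) *\<^sub>R (v2 - v1)) \<in> M"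
  then have "p \<in> M"
    by (simp add: p_def)
  have "p + p = t *\<^sub>R (v2 - v1)"
    by (simp add: p_def scaleR_left_distrib[symmetric] scaleR_add_right[symmetric])
  then have "p + t *\<^sub>R v1 = - p + t *\<^sub>R v2"
    by (simp add: algebra_simps)
  then show "moving_set M v1 t \<inter> moving_set (uminus ` M) v2 t \<noteq> {}"
    using \<open>p \<in> M\<close> unfolding moving_set_def by blast
qed

lemma collision_time_reflection:
  assumes "convex M"
  shows "collision_time M (uminus ` M) v1 v2 = hitting_time M ((1/2) *\<^sub>R (v2 - v1))"
  unfolding collision_time_def hitting_time_def moving_set_reflection_Int_nonempty_iff[OF assms] ..

text \<open>With \<open>w\<close> half the relative velocity, any common point comes from
  \<open>x\<close> and \<open>- y\<close> where \<open>x\<close> and \<open>y\<close> have midpoint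
  \<open>t w\<close>. This midpoint is not interior at the first hit, so \<open>x = y = t w\<close>,
  and adding \<open>t v1\<close> gives the location.\<close>

lemma moving_set_reflection_Int_collision:
  assumes "closed M" "strictly_convex M" "M \<inter> uminus ` M = {}"
    and fin: "collision_time M (uminus ` M) v1 v2 < \<infinity>"
  defines "t \<equiv> real_of_ereal (collision_time M (uminus ` M) v1 v2)"
  shows "moving_set M v1 t \<inter> moving_set (uminus ` M) v2 t = {t *\<^sub>R ((1/2) *\<^sub>R (v1 + v2))}"
proof -
  note conv = strictly_convex_imp_convex[OF assms(2)]
  define w where "w = (1/2) *\<^sub>R (v2 - v1)"
  have "hitting_time M w < \<infinity>"
    using fin by (simp add: w_def collision_time_reflection[OF conv])
  with \<open>closed M\<close> obtain s where s: "0 \<le> s" "hitting_time M w = ereal s" "s *\<^sub>R w \<in> M"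
    "\<And>r. 0 \<le> r \<Longrightarrow> r *\<^sub>R w \<in> M \<Longrightarrow> s \<le> r"
    using hitting_time_attained by metis
  have "t = s"
    by (simp add: t_def collision_time_reflection[OF conv] w_def[symmetric] s(2))
  note s = s[folded \<open>t = s\<close>]
  \<comment> \<open>The origin is its own reflection, so it would lie in both disjoint sets.\<close>
  have "0 \<notin> M"
    using assms(3) by force
  then have notin: "t *\<^sub>R w \<notin> interior M"
    using s by (intro hitting_point_notin_interior)
  have v1: "t *\<^sub>R w + t *\<^sub>R v1 = t *\<^sub>R ((1/2) *\<^sub>R (v1 + v2))"
    by (simp add: w_def vec_eq_iff field_simps)
  have "z = t *\<^sub>R ((1/2) *\<^sub>R (v1 + v2))"
    if z: "z \<in> moving_set M v1 t \<inter> moving_set (uminus ` M) v2 t" for z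
  proof -
    obtain x y where xy: "x \<in> M" "y \<in> M" "z = x + t *\<^sub>R v1" "z = - y + t *\<^sub>R v2"
      using z by (auto simp: moving_set_def)
    then have "x + y = t *\<^sub>R (v2 - v1)"
      by (simp add: algebra_simps)
    then have mid: "midpoint x y = t *\<^sub>R w"
      by (simp add: midpoint_def w_def scaleR_left_commute)
    then have "x = y"
      using strictly_convex_midpoint_interior[OF assms(2) xy(1,2)] notin by simp
    then have "x = t *\<^sub>R w"
      using mid by simp
    then show ?thesis
      using xy(3) v1 by simp
  qed
  moreover have "moving_set M v1 t \<inter> moving_set (uminus ` M) v2 t \<noteq> {}"
    using s(3) by (simp add: moving_set_reflection_Int_nonempty_iff[OF conv] w_def)
  ultimately show ?thesis
    by blast
qed

theorem corollary2p2:
  fixes M1 M2 :: "(real ^ 'n) set"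
    and P :: "'w measure"
    and V1 V2 :: "'w \<Rightarrow> real ^ 'n"
    and T :: "'w \<Rightarrow> ereal"
    and C :: "'w \<Rightarrow> real ^ 'n"
  defines "T \<equiv> \<lambda>\<omega>. collision_time M1 M2 (V1 \<omega>) (V2 \<omega>)"
    and "C \<equiv> \<lambda>\<omega>. collision_location M1 M2 (V1 \<omega>) (V2 \<omega>)"
  assumes "closed M1" and "closed M2"
    and "M1 \<inter> M2 = {}"
    and "strictly_convex M1" and "strictly_convex M2"
    and "\<forall>x. x \<in> M1 \<union> M2 \<longleftrightarrow> - x \<in> M1 \<union> M2"
    and "prob_space P"
    and "distributed P lborel V1 (\<lambda>x. ennreal (std_normal_vec_density x))"
    and "distributed P lborel V2 (\<lambda>x. ennreal (std_normal_vec_density x))"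
    and "prob_space.indep_var P borel V1 borel V2"
  shows "(\<forall>\<omega>\<in>space P. T \<omega> < \<infinity> \<longrightarrow>
            moving_set M1 (V1 \<omega>) (real_of_ereal (T \<omega>)) \<inter>
            moving_set M2 (V2 \<omega>) (real_of_ereal (T \<omega>)) = {C \<omega>})
    \<and> T \<in> borel_measurable P
    \<and> C \<in> borel_measurable P
    \<and> rotation_invariant (cond_distr P {\<omega> \<in> space P. T \<omega> < \<infinity>} C)"
proof -
  note M = assms(3-8) and V = assms(10-12)
  interpret prob_space P
    by fact
  have [measurable]: "V1 \<in> borel_measurable P" "V2 \<in> borel_measurable P"
    using V(1,2) by (auto simp: distributed_def)
  \<comment> \<open>The empty case and the reflected case are brought to one form: the time is a
    measurable function of the velocity difference, and the location is explicit.\<close>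
  obtain \<tau> where \<tau>: "\<tau> \<in> borel_measurable borel"
    and T: "T = (\<lambda>\<omega>. \<tau> (V2 \<omega> - V1 \<omega>))"
    and coll: "\<And>\<omega>. T \<omega> < \<infinity> \<Longrightarrow>
      moving_set M1 (V1 \<omega>) (real_of_ereal (T \<omega>)) \<inter> moving_set M2 (V2 \<omega>) (real_of_ereal (T \<omega>))
        = {real_of_ereal (T \<omega>) *\<^sub>R ((1/2) *\<^sub>R (V1 \<omega> + V2 \<omega>))}"
  proof (cases "M1 = {} \<or> M2 = {}")
    case True
    \<comment> \<open>An empty set never collides, so the claim about the location is
      vacuous.\<close>
    then have "T = (\<lambda>\<omega>. \<infinity>)"
      by (auto simp: T_def collision_time_def moving_set_def top_ereal_def)
    then show thesis
      using that[of "\<lambda>_. \<infinity>"] by simp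
  next
    case False
    note conv = strictly_convex_imp_convex[OF M(4)] strictly_convex_imp_convex[OF M(5)]
    have "uminus ` M1 \<subseteq> M2"
      using M conv False by (intro uminus_image_subset_of_symmetric_union) blast+
    moreover have "uminus ` M2 \<subseteq> M1"
      using M conv False by (intro uminus_image_subset_of_symmetric_union) blast+
    ultimately have M2: "M2 = uminus ` M1"
      by (force simp: image_subset_iff)
    show thesis
    proof (rule that[of "\<lambda>w. hitting_time M1 ((1/2) *\<^sub>R w)"])
      show "(\<lambda>w. hitting_time M1 ((1/2) *\<^sub>R w)) \<in> borel_measurable borel"
        using borel_measurable_hitting_time[OF M(1)] by measurable
      show "T = (\<lambda>\<omega>. hitting_time M1 ((1/2) *\<^sub>R (V2 \<omega> - V1 \<omega>)))"
        unfolding T_def M2 collision_time_reflection[OF conv(1)] ..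
      show "moving_set M1 (V1 \<omega>) (real_of_ereal (T \<omega>)) \<inter> moving_set M2 (V2 \<omega>) (real_of_ereal (T \<omega>))
          = {real_of_ereal (T \<omega>) *\<^sub>R ((1/2) *\<^sub>R (V1 \<omega> + V2 \<omega>))}" if "T \<omega> < \<infinity>" for \<omega>
        using that M(1,3,4) unfolding T_def M2 by (intro moving_set_reflection_Int_collision)
    qed
  qed
  note \<tau>[measurable]
  \<comment> \<open>At infinite time \<open>real_of_ereal\<close> returns 0, so the sets are unmoved
    and the dummy location does not depend on \<omega>; this makes \<open>C\<close> measurable on
    the whole space.\<close>
  have C: "C \<omega> = (if T \<omega> < \<infinity> then real_of_ereal (T \<omega>) *\<^sub>R ((1/2) *\<^sub>R (V1 \<omega> + V2 \<omega>))
      else the_elem (M1 \<inter> M2))" for \<omega>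
  proof (cases "T \<omega> < \<infinity>")
    case True
    then show ?thesis
      using coll[OF True] by (simp add: C_def collision_location_def Let_def T_def)
  next
    case False
    then show ?thesis
      by (simp add: C_def collision_location_def Let_def T_def moving_set_def)
  qed
  have T_meas[measurable]: "T \<in> borel_measurable P"
    unfolding T by measurable
  have C_meas[measurable]: "C \<in> borel_measurable P"
    unfolding C[abs_def] by measurable
  have "rotation_invariant (cond_distr P {\<omega> \<in> space P. T \<omega> < \<infinity>} C)"
    unfolding T using V \<tau> C_meas
    by (rule rotation_invariant_cond_distr_scaled_sum) (simp add: C T)
  then show ?thesis
    using coll T_meas C_meas by (auto simp: C)
qed

end
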